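(* Let $p\ge1$ and $r\ge1$ be integers. Then $$G^{(p)}_r(t,u,v,z)=t^rz^r\left(\frac{tuv(v^p-1)}{v\delta_1-1}+\frac{t(z(v-1)-v)}{v\delta_1-1}\sum_{k\ge1}\frac{u^k(\delta_{k-1}^p-\delta_k^p)}{\gamma_1\cdots\gamma_k\,\delta_{k-1}^p\delta_k^p}+\frac{tuv^{p+1}}{v\delta_1-1}\sum_{k\ge1}\frac{(uv)^k(\bar\delta_{k-1}^p-\bar\delta_k^p)}{\bar\gamma_1\cdots\bar\gamma_k\,\bar\delta_{k-1}^p\bar\delta_k^p}\right).$$
   Context: For a finite integer sequence $(a_1,\dots,a_i)$, $\mathrm{asc}(a_1,\dots,a_i)=|\{j:1\le j<i,\ a_j<a_{j+1}\}|$. For an integer $p\ge1$, a $p$-ascent sequence of length $n\ge1$ is a sequence $(a_1,\dots,a_n)$ of nonnegative integers with $a_1=0$ and $a_i\le p+\mathrm{asc}(a_1,\dots,a_{i-1})$ for all $2\le i\le n$. For a sequence $w$, $|w|$ is its length, $\mathrm{asc}(w)$ its number of ascents, $\mathrm{last}(w)$ its last letter, and $|w|_0$ its number of zeros. For $r\ge1$, $G^{(p)}_r(t,u,v,z)=\sum_w t^{|w|}u^{\mathrm{asc}(w)}v^{\mathrm{last}(w)}z^{|w|_0}$, summed over all $p$-ascent sequences $w$ that begin with exactly $r$ zeros followed by a nonzero letter. Define $\delta_0=\gamma_0=\bar\delta_0=\bar\gamma_0=1$ and, for $k\ge1$, $\delta_k=u-(1-t)^k(u-1)$, $\gamma_k=u-(1-zt)(1-t)^{k-1}(u-1)$,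 $\bar\delta_k=uv-(1-t)^k(uv-1)$, $\bar\gamma_k=uv-(1-zt)(1-t)^{k-1}(uv-1)$. *)

theory Defs
  imports Complex_Main "HOL-Computational_Algebra.Formal_Power_Series"
begin

definition asc :: "nat list \<Rightarrow> nat" where
  "asc w = card {j. Suc j < length w \<and> w ! j < w ! Suc j}"

text \<open>With 0-based indexing, the letter \<open>w ! i\<close> is preceded by the prefix \<open>take i w\<close>.\<close>

definition p_ascent_seq :: "nat \<Rightarrow> nat list \<Rightarrow> bool" where
  "p_ascent_seq p w \<longleftrightarrow>
     length w \<ge> 1 \<and> w ! 0 = 0 \<and>
     (\<forall>i. 1 \<le> i \<and> i < length w \<longrightarrow> w ! i \<le> p + asc (take i w))"

definition starts_with_zeros :: "nat \<Rightarrow> nat list \<Rightarrow> bool" where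
  "starts_with_zeros r w \<longleftrightarrow> r < length w \<and> (\<forall>i<r. w ! i = 0) \<and> w ! r \<noteq> 0"

text \<open>
  Formal power series in \<open>u, t, v, z\<close> over the rationals, as iterated univariate series:
  the outermost variable is \<open>u\<close>, followed by \<open>t\<close>, \<open>v\<close> and \<open>z\<close>.
  Infinite sums are taken in the metric of the outermost level, that is, \<open>u\<close>-adically; so that a
  series whose \<open>k\<close>-th term is divisible by \<open>u\<^sup>k\<close> converges.
\<close>

type_synonym gf = "rat fps fps fps fps"

definition u :: gf where "u = fps_X"
definition t :: gf where "t = fps_const fps_X"
definition v :: gf where "v = fps_const (fps_const fps_X)"
definition z :: gf where "z = fps_const (fps_const (fps_const fps_X))"

text \<open>
  The sum of the monomials of all words \<open>w\<close>: the coefficient of \<open>u\<^sup>a t\<^sup>n v\<^sup>l z\<^sup>m\<close>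
  is the number of words with these statistics.  The sets are finite, see \<open>finite_words\<close> below.
\<close>

definition words :: "nat \<Rightarrow> nat \<Rightarrow> nat \<Rightarrow> nat \<Rightarrow> nat \<Rightarrow> nat \<Rightarrow> nat list set" where
  "words p r n a l m =
     {w. p_ascent_seq p w \<and> starts_with_zeros r w \<and>
         length w = n \<and> asc w = a \<and> last w = l \<and> count_list w 0 = m}"

definition G :: "nat \<Rightarrow> nat \<Rightarrow> gf" where
  "G p r = Abs_fps (\<lambda>a. Abs_fps (\<lambda>n. Abs_fps (\<lambda>l. Abs_fps (\<lambda>m.
     of_nat (card (words p r n a l m))))))"

definition \<delta> :: "nat \<Rightarrow> gf" where
  "\<delta> k = (if k = 0 then 1 else u - (1 - t) ^ k * (u - 1))"

definition \<gamma> :: "nat \<Rightarrow> gf" where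
  "\<gamma> k = (if k = 0 then 1 else u - (1 - z * t) * (1 - t) ^ (k - 1) * (u - 1))"

definition \<delta>bar :: "nat \<Rightarrow> gf" where
  "\<delta>bar k = (if k = 0 then 1 else u * v - (1 - t) ^ k * (u * v - 1))"

definition \<gamma>bar :: "nat \<Rightarrow> gf" where
  "\<gamma>bar k = (if k = 0 then 1 else u * v - (1 - z * t) * (1 - t) ^ (k - 1) * (u * v - 1))"

subsection \<open>Well-definedness\<close>

lemma finite_words: "finite (words p r n a l m)"
proof -
  have asc_le: "asc w \<le> length w" for w
  proof -
    have "asc w \<le> card {..<length w}"
      unfolding asc_def by (rule card_mono) auto
    then show ?thesis by simp
  qed
  have "words p r n a l m \<subseteq> {w. set w \<subseteq> {..p + n} \<and> length w = n}"
  proof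
    fix w assume "w \<in> words p r n a l m"
    then have w: "p_ascent_seq p w" "length w = n"
      by (auto simp: words_def)
    have "w ! i \<le> p + n" if "i < n" for i
    proof (cases "i = 0")
      case True
      then show ?thesis using w by (simp add: p_ascent_seq_def)
    next
      case False
      then have "w ! i \<le> p + asc (take i w)"
        using w that by (simp add: p_ascent_seq_def)
      also have "asc (take i w) \<le> n"
        using asc_le[of "take i w"] that w by simp
      finally show ?thesis by simp
    qed
    then show "w \<in> {w. set w \<subseteq> {..p + n} \<and> length w = n}"
      using w by (auto simp: in_set_conv_nth)
  qed
  then show ?thesis
    by (rule finite_subset) (simp add: finite_lists_length_eq)
qed

text \<open>
  Every denominator has constant coefficient \<open>\<plusminus>1\<close>, so the divisions are genuine divisions
  by units of the power series ring.
\<close>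

definition const_coeff :: "gf \<Rightarrow> rat" where
  "const_coeff f = fps_nth (fps_nth (fps_nth (fps_nth f 0) 0) 0) 0"

lemma const_coeff_simps [simp]:
  "const_coeff 0 = 0" "const_coeff 1 = 1"
  "const_coeff (f + g) = const_coeff f + const_coeff g"
  "const_coeff (f - g) = const_coeff f - const_coeff g"
  "const_coeff (f * g) = const_coeff f * const_coeff g"
  "const_coeff u = 0" "const_coeff t = 0" "const_coeff v = 0" "const_coeff z = 0"
  by (simp_all add: const_coeff_def u_def t_def v_def z_def)

lemma const_coeff_power [simp]: "const_coeff (f ^ n) = const_coeff f ^ n"
  by (induction n) simp_all

lemma const_coeff_prod [simp]: "const_coeff (\<Prod>i\<in>A. f i) = (\<Prod>i\<in>A. const_coeff (f i))"
  by (induction A rule: infinite_finite_induct) simp_all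

lemma const_coeff_denominators [simp]:
  "const_coeff (\<delta> k) = 1" "const_coeff (\<gamma> k) = 1"
  "const_coeff (\<delta>bar k) = 1" "const_coeff (\<gamma>bar k) = 1"
  "const_coeff (v * \<delta> (Suc 0) - 1) = -1"
  by (simp_all add: \<delta>_def \<gamma>_def \<delta>bar_def \<gamma>bar_def)

lemma fps_mult_inverse_unit:
  fixes f :: "'a::{comm_ring_1,inverse} fps"
  assumes "fps_nth f 0 * inverse (fps_nth f 0) = 1"
  shows "f * inverse f = 1"
  unfolding fps_inverse_def by (rule fps_right_inverse[OF assms])

lemma gf_mult_inverse:
  assumes "const_coeff f \<noteq> 0"
  shows "f * inverse f = 1"
  using assms unfolding const_coeff_def
  by (intro fps_mult_inverse_unit right_inverse)

lemma gf_divide_eq: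
  assumes "const_coeff g \<noteq> 0"
  shows "f / g = f * inverse g"
proof -
  have "fps_nth g 0 \<noteq> 0" using assms by (auto simp: const_coeff_def)
  then show ?thesis by (rule fps_divide_unit)
qed

lemma gf_divide_mult_cancel:
  assumes "const_coeff g \<noteq> 0"
  shows "f / g * g = f"
proof -
  have "f / g * g = f * (g * inverse g)"
    by (simp only: gf_divide_eq[OF assms] mult.assoc mult.commute[of "inverse g"])
  then show ?thesis by (simp only: gf_mult_inverse[OF assms] mult_1_right)
qed

text \<open>Both infinite series converge.\<close>

lemma summable_gf:
  fixes f :: "nat \<Rightarrow> gf"
  shows "summable (\<lambda>k. u ^ Suc k * f k)"
proof -
  let ?g = "\<lambda>k. u ^ Suc k * f k"
  have z: "fps_nth (?g k) n = 0" if "n \<le> k" for k n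
    using that by (simp only: u_def fps_X_power_mult_nth) simp
  have "(\<lambda>N. sum ?g {..<N}) \<longlonglongrightarrow> Abs_fps (\<lambda>n. \<Sum>k<n. fps_nth (?g k) n)"
  proof (rule tendsto_fpsI)
    fix n
    show "eventually (\<lambda>N. fps_nth (sum ?g {..<N}) n =
      fps_nth (Abs_fps (\<lambda>n. \<Sum>k<n. fps_nth (?g k) n)) n) sequentially"
    proof (rule eventually_sequentiallyI[of n])
      fix N assume "n \<le> N"
      then have "(\<Sum>k<N. fps_nth (?g k) n) = (\<Sum>k<n. fps_nth (?g k) n)"
        by (intro sum.mono_neutral_right) (auto simp del: power_Suc simp: z)
      then show "fps_nth (sum ?g {..<N}) n =
        fps_nth (Abs_fps (\<lambda>n. \<Sum>k<n. fps_nth (?g k) n)) n"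
        by (simp only: fps_sum_nth fps_nth_Abs_fps)
    qed
  qed
  then show ?thesis unfolding summable_def sums_def by blast
qed

lemma summable_delta_series:
  "summable (\<lambda>k. u ^ Suc k * (\<delta> k ^ p - \<delta> (Suc k) ^ p) /
     ((\<Prod>i=1..Suc k. \<gamma> i) * \<delta> k ^ p * \<delta> (Suc k) ^ p))"
  by (subst gf_divide_eq)
     (simp_all only: const_coeff_simps const_coeff_power const_coeff_prod
        const_coeff_denominators power_one prod.neutral_const mult_1_right
        one_neq_zero not_False_eq_True mult.assoc summable_gf)

lemma summable_delta_bar_series:
  "summable (\<lambda>k. (u * v) ^ Suc k * (\<delta>bar k ^ p - \<delta>bar (Suc k) ^ p) /
     ((\<Prod>i=1..Suc k. \<gamma>bar i) * \<delta>bar k ^ p * \<delta>bar (Suc k) ^ p))"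
  by (subst gf_divide_eq)
     (simp_all only: const_coeff_simps const_coeff_power const_coeff_prod
        const_coeff_denominators power_one prod.neutral_const mult_1_right
        one_neq_zero not_False_eq_True mult.assoc power_mult_distrib summable_gf)

end

theory Submission
  imports Defs
begin

text \<open>
  Appending a letter to a word gives a functional equation expressing \<open>F(u, v)\<close>, the series of the
  theorem, through \<open>F(u, 1)\<close> and \<open>F(uv, 1)\<close>, with the kernel \<open>v \<delta>\<^sub>1 - 1\<close> as the factor of
  \<open>F(u, v)\<close>.  It remains to find \<open>H(u) = F(u, 1)\<close>.  The substitution \<open>v = 1 / \<delta>\<^sub>1\<close> annihilates
  the kernel and expresses \<open>H(u)\<close> through \<open>H(u / \<delta>\<^sub>1)\<close>.  Since iterating \<open>u \<mapsto> u / \<delta>\<^sub>1\<close> leads from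
  \<open>u\<close> to \<open>u / \<delta>\<^sub>k\<close>, the iterated equation is the partial sum of the first series, up to a
  remainder divisible by \<open>u\<^sup>k\<close>.  The same with \<open>uv\<close> in place of \<open>u\<close> gives the second series.

  As the number of ascents bounds the last letter, the coefficient of \<open>u\<^sup>a\<close> is a polynomial in \<open>v\<close>.
  Hence \<open>F(x, y)\<close> makes sense for every \<open>y\<close> and every multiple \<open>x\<close> of \<open>u\<close>, which gives a
  meaning to all these substitutions.
\<close>

section \<open>Sums in the u-adic topology\<close>

text \<open>Convergence with a rate: the first \<open>N\<close> terms give the sum modulo
  \<open>u ^ N\<close>. Later arguments can then use divisibility instead of limits.\<close>

definition u_sums :: "(nat \<Rightarrow> gf) \<Rightarrow> gf \<Rightarrow> bool" where
  "u_sums f s \<longleftrightarrow> (\<forall>N. u ^ N dvd s - sum f {..<N})"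

lemma u_power_dvd_iff: "u ^ N dvd f \<longleftrightarrow> (\<forall>n<N. fps_nth f n = 0)"
proof
  assume "u ^ N dvd f"
  then show "\<forall>n<N. fps_nth f n = 0"
    by (auto simp: u_def fps_X_power_mult_nth elim!: dvdE)
next
  assume "\<forall>n<N. fps_nth f n = 0"
  then have "f = u ^ N * fps_shift N f"
    by (intro fps_ext) (auto simp: u_def fps_X_power_mult_nth)
  then show "u ^ N dvd f" by (rule dvdI)
qed

lemma u_sums_imp_sums:
  assumes "u_sums f s"
  shows "f sums s"
  unfolding sums_def
proof (rule tendsto_fpsI)
  fix n
  show "eventually (\<lambda>N. fps_nth (sum f {..<N}) n = fps_nth s n) sequentially"
  proof (rule eventually_sequentiallyI[of "Suc n"])
    fix N assume "Suc n \<le> N"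
    moreover have "u ^ N dvd s - sum f {..<N}"
      using assms by (simp add: u_sums_def)
    ultimately show "fps_nth (sum f {..<N}) n = fps_nth s n"
      unfolding u_power_dvd_iff fps_sub_nth by (metis Suc_le_eq eq_iff_diff_eq_0)
  qed
qed

lemma u_sums_unique:
  assumes "u_sums f s"
  shows "suminf f = s"
  using sums_unique[OF u_sums_imp_sums[OF assms]] by simp

lemma u_sums_mult:
  assumes "u_sums f s"
  shows "u_sums (\<lambda>k. c * f k) (c * s)"
  using assms unfolding u_sums_def
  by (simp flip: sum_distrib_left right_diff_distrib)

lemma eq_if_u_power_dvd_diff:
  assumes "\<And>N. u ^ Suc N dvd f - g"
  shows "f = g"
proof (rule fps_ext)
  fix n
  have "u ^ Suc n dvd f - g" by (rule assms)
  then show "fps_nth f n = fps_nth g n"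
    unfolding u_power_dvd_iff fps_sub_nth by (metis lessI eq_iff_diff_eq_0)
qed

text \<open>Only the terms with \<open>k \<le> n\<close> reach the coefficient of
  \<open>u ^ n\<close>, so the sum can be defined coefficientwise.\<close>

lemma u_sums_power_mult:
  assumes "u dvd x"
  shows "u_sums (\<lambda>k. x ^ k * f k) (\<Sum>k. x ^ k * f k)"
proof -
  let ?f = "\<lambda>k. x ^ k * f k"
  define s where "s = Abs_fps (\<lambda>n. \<Sum>k\<le>n. fps_nth (?f k) n)"
  have zero: "fps_nth (?f k) n = 0" if "n < k" for k n
  proof -
    have "u ^ k dvd ?f k" using assms by (intro dvd_mult2 dvd_power_same)
    then show ?thesis using that unfolding u_power_dvd_iff by blast
  qed
  have "u_sums ?f s"
    unfolding u_sums_def u_power_dvd_iff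
  proof (intro allI impI)
    fix N n :: nat assume "n < N"
    then have "(\<Sum>k<N. fps_nth (?f k) n) = (\<Sum>k\<le>n. fps_nth (?f k) n)"
      by (intro sum.mono_neutral_right) (auto simp: zero)
    then show "fps_nth (s - sum ?f {..<N}) n = 0"
      by (simp add: s_def fps_sum_nth)
  qed
  then show ?thesis using u_sums_unique by fastforce
qed

section \<open>Appending a letter\<close>

lemma asc_snoc:
  assumes "w \<noteq> []"
  shows "asc (w @ [l]) = asc w + (if last w < l then 1 else 0)"
proof -
  obtain n where n: "length w = Suc n" using assms by (cases w) auto
  let ?A = "{j. Suc j < length w \<and> w ! j < w ! Suc j}"
  have "{j. Suc j < length (w @ [l]) \<and> (w @ [l]) ! j < (w @ [l]) ! Suc j}
      = ?A \<union> (if last w < l then {n} else {})"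
    using n assms by (auto simp: nth_append last_conv_nth less_Suc_eq split: if_splits)
  moreover have "finite ?A" by (rule finite_subset[of _ "{..<length w}"]) auto
  moreover have "n \<notin> ?A" using n by simp
  ultimately show ?thesis by (simp add: asc_def)
qed

lemma asc_replicate [simp]: "asc (replicate n x) = 0"
proof -
  have "{j. Suc j < n \<and> replicate n x ! j < replicate n x ! Suc j} = {}"
    by auto
  then show ?thesis by (simp only: asc_def length_replicate card.empty)
qed

lemma p_ascent_seq_snoc:
  assumes "w \<noteq> []"
  shows "p_ascent_seq p (w @ [l]) \<longleftrightarrow> p_ascent_seq p w \<and> l \<le> p + asc w"
proof -
  have "(\<forall>i. 1 \<le> i \<and> i < length (w @ [l]) \<longrightarrow> (w @ [l]) ! i \<le> p + asc (take i (w @ [l])))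
    \<longleftrightarrow> (\<forall>i. 1 \<le> i \<and> i < length w \<longrightarrow> w ! i \<le> p + asc (take i w)) \<and> l \<le> p + asc w"
    using assms by (auto simp: nth_append less_Suc_eq Suc_le_eq all_conj_distrib imp_disjL)
  then show ?thesis
    using assms by (auto simp: p_ascent_seq_def nth_append Suc_le_eq)
qed

text \<open>The word \<open>replicate r 0\<close> is not yet in the class; it starts the recursion
  and produces the inhomogeneous term of the functional equation.\<close>

lemma starts_with_zeros_snoc:
  "starts_with_zeros r (w @ [l]) \<longleftrightarrow> starts_with_zeros r w \<or> w = replicate r 0 \<and> l \<noteq> 0"
proof (cases "r < length w")
  case True
  then show ?thesis by (auto simp: starts_with_zeros_def nth_append)
next
  case False
  then show ?thesis
    by (auto simp: starts_with_zeros_def nth_append list_eq_iff_nth_eq less_Suc_eq)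
qed

text \<open>The number of zeros is left free here; it enters later as a weight.\<close>

definition asc_words :: "nat \<Rightarrow> nat \<Rightarrow> nat \<Rightarrow> nat \<Rightarrow> nat \<Rightarrow> nat list set" where
  "asc_words p r n a l =
     {w. p_ascent_seq p w \<and> starts_with_zeros r w \<and> length w = n \<and> asc w = a \<and> last w = l}"

lemma asc_words_0 [simp]: "asc_words p r 0 a l = {}"
  by (auto simp: asc_words_def p_ascent_seq_def)

lemma p_ascent_seq_replicate: "r \<ge> 1 \<Longrightarrow> p_ascent_seq p (replicate r 0)"
  by (auto simp: p_ascent_seq_def)

text \<open>Three sources: the initial zeros, a new letter that makes no ascent, and one that makes
  an ascent. The bound on the new letter counts the ascents before it, hence \<open>a'\<close> in
  the last case.\<close>

lemma snoc_mem_asc_words_iff: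
  assumes "r \<ge> 1"
  shows "w @ [l'] \<in> asc_words p r (Suc n) a l \<longleftrightarrow>
    l' = l \<and> (w = replicate r 0 \<and> n = r \<and> a = 1 \<and> 0 < l \<and> l \<le> p \<or>
      (\<exists>b. w \<in> asc_words p r n a b \<and> l \<le> b \<and> l \<le> p + a) \<or>
      (\<exists>a' b. a = Suc a' \<and> w \<in> asc_words p r n a' b \<and> b < l \<and> l \<le> p + a'))"
proof (cases "w = []")
  case True
  then show ?thesis using assms
    by (auto simp: asc_words_def p_ascent_seq_def starts_with_zeros_def)
next
  case False
  have "\<not> starts_with_zeros r (replicate r 0)" by (simp add: starts_with_zeros_def)
  then show ?thesis
    using False assms
    by (cases "last w < l")
      (auto simp: asc_words_def asc_snoc p_ascent_seq_snoc starts_with_zeros_snoc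
        p_ascent_seq_replicate last_replicate)
qed

text \<open>Without an ascent the last letter does not grow. With an ascent it is at most
  \<open>p\<close> plus the old number of ascents, which is one less than the new number; hence the
  strict bound.\<close>

lemma last_less_if_mem_asc_words:
  assumes "r \<ge> 1" and "w \<in> asc_words p r n a l"
  shows "l < p + a \<and> 0 < a"
  using assms(2)
proof (induction n arbitrary: w a l)
  case 0
  then show ?case by simp
next
  case (Suc n)
  then have "length w = Suc n" by (simp add: asc_words_def)
  then obtain w' l' where w: "w = w' @ [l']" by (metis length_Suc_conv_rev)
  show ?case
    using Suc.prems Suc.IH unfolding w snoc_mem_asc_words_iff[OF assms(1)]
    by fastforce
qed

lemma asc_words_eq_empty:
  assumes "r \<ge> 1" and "a = 0 \<or> p + a \<le> l"
  shows "asc_words p r n a l = {}"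
  using last_less_if_mem_asc_words[OF assms(1)] assms(2) by fastforce

text \<open>By the strict bound on last letters, \<open>l \<le> p + a\<close> is the full range for
  \<open>Suc a\<close> ascents. Within this range the new letter always satisfies the ascent
  condition, so the constraint disappears from all three sources.\<close>

lemma asc_words_Suc:
  assumes "r \<ge> 1" and "l \<le> p + a"
  shows "asc_words p r (Suc n) (Suc a) l = (\<lambda>w. w @ [l]) `
    ((if n = r \<and> a = 0 \<and> 0 < l then {replicate r 0} else {}) \<union>
     ((\<Union>b\<in>{l..p + a}. asc_words p r n (Suc a) b) \<union> (\<Union>b\<in>{..<l}. asc_words p r n a b)))"
    (is "_ = ?f ` ?S")
proof (rule set_eqI)
  fix w
  show "w \<in> asc_words p r (Suc n) (Suc a) l \<longleftrightarrow> w \<in> ?f ` ?S"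
  proof (cases "w = []")
    case True
    then show ?thesis by (auto simp: asc_words_def)
  next
    case False
    then obtain w' l' where w: "w = w' @ [l']" by (metis rev_exhaust)
    have "b \<le> p + a" if "w' \<in> asc_words p r n (Suc a) b" for b
      using last_less_if_mem_asc_words[OF assms(1) that] by simp
    then have "w' \<in> (\<Union>b\<in>{l..p + a}. asc_words p r n (Suc a) b) \<longleftrightarrow>
        (\<exists>b. w' \<in> asc_words p r n (Suc a) b \<and> l \<le> b \<and> l \<le> p + Suc a)"
      using assms(2) by auto
    moreover have "w' \<in> (\<Union>b\<in>{..<l}. asc_words p r n a b) \<longleftrightarrow>
        (\<exists>a' b. Suc a = Suc a' \<and> w' \<in> asc_words p r n a' b \<and> b < l \<and> l \<le> p + a')"
      using assms(2) by auto
    moreover have "w' \<in> (if n = r \<and> a = 0 \<and> 0 < l then {replicate r 0} else {}) \<longleftrightarrow>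
        w' = replicate r 0 \<and> n = r \<and> Suc a = 1 \<and> 0 < l \<and> l \<le> p"
      using assms(2) by auto
    moreover have "w' @ [l'] \<in> ?f ` ?S \<longleftrightarrow> l' = l \<and> w' \<in> ?S"
      by blast
    ultimately show ?thesis
      unfolding w snoc_mem_asc_words_iff[OF assms(1)] by (simp only: Un_iff)
  qed
qed

lemma words_eq_filter_asc_words:
  "words p r n a l m = {w \<in> asc_words p r n a l. count_list w 0 = m}"
  by (auto simp: words_def asc_words_def)

lemma finite_asc_words [simp]: "finite (asc_words p r n a l)"
proof -
  have "asc_words p r n a l \<subseteq> (\<Union>m\<in>{..n}. words p r n a l m)"
    using count_le_length by (fastforce simp: words_def asc_words_def)
  then show ?thesis by (rule finite_subset) (simp add: finite_words)
qed

section \<open>Weighting the words by their zeros\<close>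

lemma count_list_replicate: "count_list (replicate n x) x = n"
  by (induction n) simp_all

definition zeros_poly :: "nat \<Rightarrow> nat \<Rightarrow> nat \<Rightarrow> nat \<Rightarrow> nat \<Rightarrow> rat fps" where
  "zeros_poly p r n a l = (\<Sum>w\<in>asc_words p r n a l. fps_X ^ count_list w 0)"

lemma zeros_poly_eq: "zeros_poly p r n a l = Abs_fps (\<lambda>m. of_nat (card (words p r n a l m)))"
proof (rule fps_ext)
  fix m
  have "fps_nth (zeros_poly p r n a l) m =
      (\<Sum>w\<in>asc_words p r n a l. if count_list w 0 = m then 1 else 0)"
    by (simp add: zeros_poly_def fps_sum_nth fps_X_power_nth eq_commute)
  also have "\<dots> = of_nat (card (words p r n a l m))"
    by (simp add: words_eq_filter_asc_words flip: sum.inter_filter)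
  finally show "fps_nth (zeros_poly p r n a l) m =
      fps_nth (Abs_fps (\<lambda>m. of_nat (card (words p r n a l m)))) m" by simp
qed

lemma zeros_poly_Suc:
  assumes "r \<ge> 1" and "l \<le> p + a"
  shows "zeros_poly p r (Suc n) (Suc a) l =
    (if n = r \<and> a = 0 \<and> 0 < l then fps_X ^ r else 0) +
    (if l = 0 then fps_X else 1) *
      ((\<Sum>b=l..p + a. zeros_poly p r n (Suc a) b) + (\<Sum>b<l. zeros_poly p r n a b))"
proof -
  let ?B = "if n = r \<and> a = 0 \<and> 0 < l then {replicate r 0 :: nat list} else {}"
  let ?S = "\<Union>b\<in>{l..p + a}. asc_words p r n (Suc a) b"
  let ?T = "\<Union>b\<in>{..<l}. asc_words p r n a b"
  let ?k = "if l = 0 then fps_X else 1 :: rat fps"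
  let ?g = "\<lambda>w. fps_X ^ count_list w 0 :: rat fps"
  have "zeros_poly p r (Suc n) (Suc a) l = (\<Sum>w\<in>?B \<union> (?S \<union> ?T). ?k * ?g w)"
    unfolding zeros_poly_def asc_words_Suc[OF assms]
    by (subst sum.reindex) (auto intro!: inj_onI sum.cong)
  also have "\<dots> = (\<Sum>w\<in>?B. ?k * ?g w) + ((\<Sum>w\<in>?S. ?k * ?g w) + (\<Sum>w\<in>?T. ?k * ?g w))"
  proof -
    \<comment> \<open>The initial zeros fail \<open>starts_with_zeros\<close>, and \<open>?S\<close>
      and \<open>?T\<close> differ in the number of ascents.\<close>
    have "?B \<inter> (?S \<union> ?T) = {}" "?S \<inter> ?T = {}"
      by (auto simp: asc_words_def starts_with_zeros_def)
    then show ?thesis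
      by (simp add: sum.union_disjoint)
  qed
  also have "(\<Sum>w\<in>?S. ?k * ?g w) = ?k * (\<Sum>b=l..p + a. zeros_poly p r n (Suc a) b)"
    unfolding zeros_poly_def sum_distrib_left
    by (rule sum.UNION_disjoint, simp, simp, auto simp: asc_words_def)
  also have "(\<Sum>w\<in>?T. ?k * ?g w) = ?k * (\<Sum>b<l. zeros_poly p r n a b)"
    unfolding zeros_poly_def sum_distrib_left
    by (rule sum.UNION_disjoint, simp, simp, auto simp: asc_words_def)
  also have "(\<Sum>w\<in>?B. ?k * ?g w) = (if n = r \<and> a = 0 \<and> 0 < l then fps_X ^ r else 0)"
    by (cases "n = r \<and> a = 0 \<and> 0 < l") (simp_all add: count_list_replicate)
  finally show ?thesis unfolding distrib_left .
qed

section \<open>The functional equation\<close>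

lemma fps_const_sum: "fps_const (\<Sum>i\<in>A. f i) = (\<Sum>i\<in>A. fps_const (f i))"
  by (induction A rule: infinite_finite_induct) (simp_all flip: fps_const_add)

text \<open>Constant in \<open>u\<close> and \<open>v\<close>, so that other series can take the
  places of these two variables.\<close>

definition coef :: "nat \<Rightarrow> nat \<Rightarrow> nat \<Rightarrow> nat \<Rightarrow> gf" where
  "coef p r a l = fps_const (Abs_fps (\<lambda>n. fps_const (zeros_poly p r n a l)))"

lemma coef_eq_0:
  assumes "r \<ge> 1" and "a = 0 \<or> p + a \<le> l"
  shows "coef p r a l = 0"
proof -
  have "zeros_poly p r n a l = 0" for n
    by (simp add: zeros_poly_def asc_words_eq_empty[OF assms])
  then show ?thesis by (simp add: coef_def fps_eq_iff)
qed

lemma coef_Suc: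
  assumes "r \<ge> 1" and "l \<le> p + a"
  shows "coef p r (Suc a) l =
    (if a = 0 \<and> 0 < l then t ^ Suc r * z ^ r else 0) +
    t * (if l = 0 then z else 1) *
      ((\<Sum>b=l..p + a. coef p r (Suc a) b) + (\<Sum>b<l. coef p r a b))"
proof -
  define A where "A a l = Abs_fps (\<lambda>n. fps_const (zeros_poly p r n a l))" for a l
  let ?X = "fps_X :: rat fps fps fps"
  let ?Z = "fps_const (fps_const fps_X) :: rat fps fps fps"
  have "A (Suc a) l =
    (if a = 0 \<and> 0 < l then ?X ^ Suc r * ?Z ^ r else 0) +
    ?X * ((if l = 0 then ?Z else 1) * ((\<Sum>b=l..p + a. A (Suc a) b) + (\<Sum>b<l. A a b)))"
    (is "_ = ?R")
  proof (rule fps_ext)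
    fix n
    show "fps_nth (A (Suc a) l) n = fps_nth ?R n"
    proof (cases n)
      case 0
      then show ?thesis by (simp add: A_def zeros_poly_def)
    next
      case (Suc k)
      then show ?thesis
        by (simp add: A_def zeros_poly_Suc[OF assms] fps_sum_nth fps_X_power_mult_nth
            mult.assoc del: power_Suc flip: fps_const_sum)
    qed
  qed
  then show ?thesis
    unfolding coef_def A_def[symmetric]
    by (simp add: t_def z_def mult.assoc flip: fps_const_sum)
qed

definition last_poly :: "nat \<Rightarrow> nat \<Rightarrow> nat \<Rightarrow> gf \<Rightarrow> gf" where
  "last_poly p r a y = (\<Sum>l<p + a. coef p r a l * y ^ l)"

text \<open>Below, \<open>x\<close> is always a multiple of \<open>u\<close>, so that the sum
  converges; \<open>y\<close> is arbitrary, as \<open>last_poly\<close> is a finite sum.\<close>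

definition series :: "nat \<Rightarrow> nat \<Rightarrow> gf \<Rightarrow> gf \<Rightarrow> gf" where
  "series p r x y = (\<Sum>a. x ^ a * last_poly p r a y)"

text \<open>Each \<open>b\<close> precedes the letters \<open>l \<le> b\<close>, and the factor
  \<open>y - 1\<close> closes the geometric sum over them. The weight of a new zero is
  \<open>c\<close>.\<close>

lemma sum_weak_descents:
  fixes y c :: "'a::comm_ring_1"
  shows "(y - 1) * (\<Sum>l\<le>n. (if l = 0 then c else 1) * (\<Sum>b=l..n. f b) * y ^ l) =
    (\<Sum>b\<le>n. f b * (c * (y - 1) + y ^ Suc b - y))"
proof (induction n)
  case 0
  then show ?case by (simp add: algebra_simps)
next
  case (Suc n)
  have geo: "(y - 1) * (\<Sum>l\<le>n. (if l = 0 then c else 1) * y ^ l) = c * (y - 1) + y ^ Suc n - y" for n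
    by (induction n) (simp_all add: algebra_simps)
  let ?k = "\<lambda>l. if l = 0 then c else 1"
  have "(\<Sum>l\<le>Suc n. ?k l * (\<Sum>b=l..Suc n. f b) * y ^ l) =
      (\<Sum>l\<le>n. ?k l * (\<Sum>b=l..n. f b) * y ^ l + f (Suc n) * (?k l * y ^ l)) + f (Suc n) * y ^ Suc n"
    by (auto simp: algebra_simps intro!: sum.cong)
  also have "\<dots> = (\<Sum>l\<le>n. ?k l * (\<Sum>b=l..n. f b) * y ^ l)
      + f (Suc n) * (\<Sum>l\<le>Suc n. ?k l * y ^ l)"
    by (simp add: sum.distrib sum_distrib_left algebra_simps)
  finally have "(y - 1) * (\<Sum>l\<le>Suc n. ?k l * (\<Sum>b=l..Suc n. f b) * y ^ l) =
      (y - 1) * (\<Sum>l\<le>n. ?k l * (\<Sum>b=l..n. f b) * y ^ l)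
      + f (Suc n) * ((y - 1) * (\<Sum>l\<le>Suc n. ?k l * y ^ l))"
    by (simp only: distrib_left mult.left_commute)
  from this[unfolded Suc geo] show ?case
    by (simp only: sum.atMost_Suc[of "\<lambda>b. f b * (c * (y - 1) + y ^ Suc b - y)"])
qed

text \<open>Now the geometric sum runs over \<open>b < l \<le> n\<close>. An ascent never ends in a
  zero, hence no \<open>c\<close> on the right.\<close>

lemma sum_ascents:
  fixes y c :: "'a::comm_ring_1"
  shows "(y - 1) * (\<Sum>l\<le>n. (if l = 0 then c else 1) * (\<Sum>b<l. f b) * y ^ l) =
    (\<Sum>b<n. f b * (y ^ Suc n - y ^ Suc b))"
proof (induction n)
  case 0
  then show ?case by simp
next
  case (Suc n)
  have "(\<Sum>b<n. f b * (y ^ Suc (Suc n) - y ^ Suc b)) =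
      (\<Sum>b<n. f b * (y ^ Suc n - y ^ Suc b)) + (\<Sum>b<n. f b) * (y ^ Suc (Suc n) - y ^ Suc n)"
    unfolding sum_distrib_right sum.distrib[symmetric]
    by (intro sum.cong refl) (simp only: algebra_simps)
  then show ?case using Suc by (simp add: algebra_simps)
qed

section \<open>Recurrence in the number of ascents\<close>

lemma last_poly_0 [simp]: "r \<ge> 1 \<Longrightarrow> last_poly p r 0 y = 0"
  by (simp add: last_poly_def coef_eq_0)

text \<open>The three summands come from the initial zeros, the weak descents and the ascents;
  \<open>y - 1\<close> clears the denominator of the geometric sums.\<close>

lemma last_poly_Suc:
  assumes "r \<ge> 1"
  shows "(y - 1) * last_poly p r (Suc a) y =
    (if a = 0 then t ^ Suc r * z ^ r * (y ^ Suc p - y) else 0)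
    + t * ((z * (y - 1) - y) * last_poly p r (Suc a) 1 + y * last_poly p r (Suc a) y)
    + t * (y ^ Suc (p + a) * last_poly p r a 1 - y * last_poly p r a y)"
proof -
  let ?T = "if a = 0 then t ^ Suc r * z ^ r else 0"
  let ?k = "\<lambda>l. if l = 0 then z else 1"
  have geo: "(y - 1) * (\<Sum>l\<le>n. (if 0 < l then 1 else 0) * y ^ l) = y ^ Suc n - y" for n
    by (induction n) (simp_all add: algebra_simps)
  have "last_poly p r (Suc a) y =
      (\<Sum>l\<le>p + a. ?T * ((if 0 < l then 1 else 0) * y ^ l)
        + t * (?k l * (\<Sum>b=l..p + a. coef p r (Suc a) b) * y ^ l)
        + t * (?k l * (\<Sum>b<l. coef p r a b) * y ^ l))"
    unfolding last_poly_def add_Suc_right lessThan_Suc_atMost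
    by (intro sum.cong refl, subst coef_Suc[OF assms]) (simp_all add: algebra_simps)
  also have "\<dots> = ?T * (\<Sum>l\<le>p + a. (if 0 < l then 1 else 0) * y ^ l)
      + t * (\<Sum>l\<le>p + a. ?k l * (\<Sum>b=l..p + a. coef p r (Suc a) b) * y ^ l)
      + t * (\<Sum>l\<le>p + a. ?k l * (\<Sum>b<l. coef p r a b) * y ^ l)"
    by (simp only: sum.distrib sum_distrib_left)
  finally have "(y - 1) * last_poly p r (Suc a) y =
      ?T * ((y - 1) * (\<Sum>l\<le>p + a. (if 0 < l then 1 else 0) * y ^ l))
      + t * ((y - 1) * (\<Sum>l\<le>p + a. ?k l * (\<Sum>b=l..p + a. coef p r (Suc a) b) * y ^ l))
      + t * ((y - 1) * (\<Sum>l\<le>p + a. ?k l * (\<Sum>b<l. coef p r a b) * y ^ l))"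
    by (simp only: distrib_left mult.left_commute)
  also have "\<dots> = ?T * (y ^ Suc (p + a) - y)
      + t * (\<Sum>b\<le>p + a. coef p r (Suc a) b * (z * (y - 1) + y ^ Suc b - y))
      + t * (\<Sum>b<p + a. coef p r a b * (y ^ Suc (p + a) - y ^ Suc b))"
    by (simp only: geo sum_weak_descents sum_ascents)
  also have "(\<Sum>b\<le>p + a. coef p r (Suc a) b * (z * (y - 1) + y ^ Suc b - y))
      = (z * (y - 1) - y) * last_poly p r (Suc a) 1 + y * last_poly p r (Suc a) y"
    unfolding last_poly_def add_Suc_right lessThan_Suc_atMost
    by (simp add: sum_distrib_left sum.distrib[symmetric] algebra_simps del: sum.atMost_Suc)
  also have "(\<Sum>b<p + a. coef p r a b * (y ^ Suc (p + a) - y ^ Suc b))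
      = y ^ Suc (p + a) * last_poly p r a 1 - y * last_poly p r a y"
    unfolding last_poly_def
    by (simp add: sum_distrib_left sum_subtractf[symmetric] algebra_simps)
  also have "?T * (y ^ Suc (p + a) - y) = (if a = 0 then t ^ Suc r * z ^ r * (y ^ Suc p - y) else 0)"
    by simp
  finally show ?thesis .
qed

text \<open>Summation of \<open>last_poly_Suc\<close> against powers of \<open>x\<close>: in the
  ascent term the factor \<open>y ^ a\<close> joins \<open>x ^ a\<close>, which turns the argument
  \<open>x\<close> into \<open>x * y\<close>.\<close>

lemma series_functional_equation:
  assumes "r \<ge> 1" and "u dvd x"
  shows "(y - 1 - t * y * (1 - x)) * series p r x y =
    t ^ Suc r * z ^ r * x * y * (y ^ p - 1) + t * (z * (y - 1) - y) * series p r x 1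
    + t * x * y ^ Suc p * series p r (x * y) 1"
proof (rule eq_if_u_power_dvd_diff)
  fix N
  define S where "S n x y = (\<Sum>a<n. x ^ a * last_poly p r a y)" for n x y
  \<comment> \<open>An ascent raises the exponent of \<open>x\<close>, so the truncated ascent terms
    stop one index earlier. The last term supplies the part \<open>t * y * x\<close> of the
    kernel.\<close>
  have eq: "(y - 1 - t * y) * S (Suc (Suc n)) x y =
    t ^ Suc r * z ^ r * x * y * (y ^ p - 1) + t * (z * (y - 1) - y) * S (Suc (Suc n)) x 1
    + t * x * y ^ Suc p * S (Suc n) (x * y) 1 - t * x * y * S (Suc n) x y" for n
  proof (induction n)
    case 0
    have "(y - 1 - t * y) * S (Suc (Suc 0)) x y =
        x * ((y - 1) * last_poly p r (Suc 0) y) - t * y * x * last_poly p r (Suc 0) y"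
      using assms(1) by (simp add: S_def algebra_simps)
    then show ?case
      unfolding last_poly_Suc[OF assms(1)] using assms(1)
      by (simp add: S_def algebra_simps)
  next
    case (Suc n)
    have S_Suc: "S (Suc n) x y = S n x y + x ^ n * last_poly p r n y" for n x y
      by (simp add: S_def)
    let ?P = "\<lambda>y. last_poly p r (Suc (Suc n)) y"
    have "(y - 1 - t * y) * S (Suc (Suc (Suc n))) x y =
        (y - 1 - t * y) * S (Suc (Suc n)) x y
        + (x ^ Suc (Suc n) * ((y - 1) * ?P y) - t * y * x ^ Suc (Suc n) * ?P y)"
      unfolding S_Suc[of "Suc (Suc n)"] by (simp add: algebra_simps)
    then show ?case
      unfolding Suc last_poly_Suc[OF assms(1)]
      unfolding S_Suc[of "Suc (Suc n)"] S_Suc[of "Suc n" "x * y"] S_Suc[of "Suc n" x y]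
      by (simp add: algebra_simps power_add power_mult_distrib)
  qed
  have dvd: "u ^ Suc N dvd series p r x' y' - S n x' y'" if "u dvd x'" "Suc N \<le> n" for x' y' n
  proof -
    have "u ^ n dvd series p r x' y' - S n x' y'"
      using u_sums_power_mult[OF that(1)] by (simp add: u_sums_def series_def S_def)
    then show ?thesis using that(2) by (metis power_le_dvd)
  qed
  \<comment> \<open>Subtracting the truncated identity leaves a combination of tails, each divisible
    by \<open>u ^ Suc N\<close>.\<close>
  have diff: "c\<^sub>1 * (s\<^sub>1 - e\<^sub>1) - c\<^sub>2 * (s\<^sub>2 - e\<^sub>2) - c\<^sub>3 * (s\<^sub>3 - e\<^sub>3) + c\<^sub>4 * (s\<^sub>4 - e\<^sub>4) =
      c\<^sub>1 * s\<^sub>1 - c\<^sub>2 * s\<^sub>2 - c\<^sub>3 * s\<^sub>3 + c\<^sub>4 * s\<^sub>4 - b"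
    if "c\<^sub>1 * e\<^sub>1 = b + c\<^sub>2 * e\<^sub>2 + c\<^sub>3 * e\<^sub>3 - c\<^sub>4 * e\<^sub>4"
    for b c\<^sub>1 c\<^sub>2 c\<^sub>3 c\<^sub>4 s\<^sub>1 s\<^sub>2 s\<^sub>3 s\<^sub>4 e\<^sub>1 e\<^sub>2 e\<^sub>3 e\<^sub>4 :: gf
    using that by (simp add: right_diff_distrib)
  let ?d = "\<lambda>n x y. series p r x y - S n x y"
  let ?n = "Suc N" and ?m = "Suc (Suc N)"
  have "u ^ Suc N dvd (y - 1 - t * y) * ?d ?m x y - t * (z * (y - 1) - y) * ?d ?m x 1
      - t * x * y ^ Suc p * ?d ?n (x * y) 1 + t * x * y * ?d ?n x y"
    by (intro dvd_add[OF dvd_diff[OF dvd_diff]] dvd_mult; rule dvd)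
      (use assms(2) in auto)
  also have "\<dots> = (y - 1 - t * y * (1 - x)) * series p r x y -
     (t ^ Suc r * z ^ r * x * y * (y ^ p - 1) + t * (z * (y - 1) - y) * series p r x 1
      + t * x * y ^ Suc p * series p r (x * y) 1)"
    unfolding diff[OF eq[of N]] by (simp add: algebra_simps)
  finally show "u ^ Suc N dvd \<dots>" .
qed

section \<open>The kernel method\<close>

text \<open>The case \<open>x = u\<close> is \<open>\<delta>\<close> and the case
  \<open>x = u * v\<close> is \<open>\<delta>bar\<close>, so both series are treated at
  once.\<close>

definition delta :: "gf \<Rightarrow> nat \<Rightarrow> gf" where
  "delta x k = x - (1 - t) ^ k * (x - 1)"

text \<open>Unlike \<open>\<gamma>\<close>, this is not 1 at index 0; the products start at index
  1.\<close>

definition gamma :: "gf \<Rightarrow> nat \<Rightarrow> gf" where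
  "gamma x k = x - (1 - z * t) * (1 - t) ^ (k - 1) * (x - 1)"

lemma delta_0 [simp]: "delta x 0 = 1"
  by (simp add: delta_def)

lemma const_coeff_eq_0_if_u_dvd: "u dvd x \<Longrightarrow> const_coeff x = 0"
  by (auto elim!: dvdE)

lemma const_coeff_delta_gamma:
  assumes "u dvd x"
  shows "const_coeff (delta x k) = 1" "const_coeff (gamma x k) = 1"
  by (simp_all add: delta_def gamma_def const_coeff_eq_0_if_u_dvd[OF assms])

lemma t_neq_0: "t \<noteq> 0"
  by (simp add: t_def)

text \<open>
  The functional equation at \<open>(x / \<delta>\<^sub>k, \<delta>\<^sub>k / \<delta>\<^sub>k\<^sub>+\<^sub>1)\<close>, which is a zero of the kernel.
\<close>

lemma kernel_step:
  fixes p r k :: nat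
  assumes "r \<ge> 1" and "u dvd x"
  defines "H \<equiv> \<lambda>k. series p r (x * inverse (delta x k)) 1"
  shows "gamma x (Suc k) * delta x (Suc k) ^ p * H k =
    x * (t ^ r * z ^ r * (delta x k ^ p - delta x (Suc k) ^ p) + delta x k ^ p * H (Suc k))"
proof -
  define D E D' E' where defs: "D = delta x k" "E = delta x (Suc k)"
    "D' = inverse D" "E' = inverse E"
  have inv: "D * D' = 1" "E * E' = 1"
    unfolding defs by (rule gf_mult_inverse; simp add: const_coeff_delta_gamma[OF assms(2)])+
  \<comment> \<open>Dividing by \<open>D\<close> shows that \<open>E / D\<close> is the first delta
    at \<open>x / D\<close>; hence one substitution leads from \<open>x / D\<close> to
    \<open>x / E\<close>.\<close>
  have E_eq: "E = x + (1 - t) * (D - x)"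
    by (simp add: defs delta_def algebra_simps)
  \<comment> \<open>In this form gamma appears below as the coefficient of
    \<open>H k\<close>.\<close>
  have gamma_eq: "gamma x (Suc k) = D - z * (D - E)"
    by (simp add: defs gamma_def delta_def algebra_simps)
  define y where "y = D * E'"
  have yE: "y * E = D" using inv by (simp add: y_def mult.assoc mult.commute[of E'])
  have arg: "x * D' * y = x * E'" using inv by (simp add: y_def) algebra
  have "E * (y - 1 - t * y * (1 - x * D')) = 0"
    using inv yE E_eq by algebra
  moreover have "E \<noteq> 0" "D \<noteq> 0" using inv by auto
  ultimately have kernel: "y - 1 - t * y * (1 - x * D') = 0" by simp
  let ?R = "t ^ Suc r * z ^ r * (x * D') * y * (y ^ p - 1) + t * (z * (y - 1) - y) * H k
    + t * (x * D') * y ^ Suc p * H (Suc k)"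
  let ?S = "x * (t ^ r * z ^ r * (y ^ p - 1) + y ^ p * H (Suc k))"
  \<comment> \<open>Once the bare \<open>D\<close> is replaced by \<open>y * E\<close>, the factor
    \<open>t * y\<close> is common to all terms and can be cancelled.\<close>
  have "D * ?R = (D * D') * (t * y * ?S) + t * (z * (y * D - D) - y * D) * H k"
    by (simp add: algebra_simps)
  also have "\<dots> = t * y * ?S + t * (z * (y * D - y * E) - y * D) * H k"
    by (simp only: inv yE mult_1_left)
  also have "?R = 0"
    using series_functional_equation[OF assms(1), of "x * D'" y p] assms(2)
    unfolding arg kernel by (simp add: H_def defs)
  finally have "t * (y * ((D - z * (D - E)) * H k)) = t * (y * ?S)"
    by (simp add: algebra_simps)
  moreover have "y \<noteq> 0" using yE \<open>D \<noteq> 0\<close> by auto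
  ultimately have gamma_H: "gamma x (Suc k) * H k = ?S"
    unfolding gamma_eq using t_neq_0 by simp
  \<comment> \<open>Multiplication by \<open>E ^ p\<close> removes the powers of \<open>y\<close>,
    which still contain an inverse.\<close>
  have yE_p: "y ^ p * E ^ p = D ^ p" using yE by (simp flip: power_mult_distrib)
  have "gamma x (Suc k) * E ^ p * H k = E ^ p * (gamma x (Suc k) * H k)"
    by (simp only: ac_simps)
  also have "\<dots> = x * (t ^ r * z ^ r * (y ^ p * E ^ p - E ^ p) + y ^ p * E ^ p * H (Suc k))"
    unfolding gamma_H by (simp add: algebra_simps)
  finally show ?thesis
    unfolding yE_p unfolding defs .
qed

text \<open>Divided by the denominators, \<open>kernel_step\<close> telescopes: the remainder
  \<open>R k\<close> is the term with index \<open>k\<close> plus \<open>R (Suc k)\<close>, and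
  \<open>R N\<close> carries the factor \<open>x ^ N\<close>.\<close>

lemma series_one_u_sums:
  assumes "r \<ge> 1" and "u dvd x"
  shows "u_sums (\<lambda>k. t ^ r * z ^ r * (x ^ Suc k * (delta x k ^ p - delta x (Suc k) ^ p) /
     ((\<Prod>i=1..Suc k. gamma x i) * delta x k ^ p * delta x (Suc k) ^ p))) (series p r x 1)"
    (is "u_sums ?f _")
proof -
  define H where "H k = series p r (x * inverse (delta x k)) 1" for k
  define Q where "Q k = (\<Prod>i=1..k. gamma x i)" for k
  define R where "R k = x ^ k * inverse (Q k * delta x k ^ p) * H k" for k
  note cc = const_coeff_delta_gamma[OF assms(2)]
  have inv_Q: "Q k * delta x k ^ p * inverse (Q k * delta x k ^ p) = 1" for k
    by (rule gf_mult_inverse) (simp add: Q_def cc)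
  have step: "R k = ?f k + R (Suc k)" for k
  proof -
    \<comment> \<open>The denominator of the summand; it clears the fractions on both sides and,
      being nonzero, is cancelled at the end.\<close>
    let ?W = "Q (Suc k) * delta x k ^ p * delta x (Suc k) ^ p"
    let ?a = "x ^ Suc k * (delta x k ^ p - delta x (Suc k) ^ p)"
    have cW: "const_coeff ?W = 1" by (simp add: Q_def cc)
    have Q_Suc: "Q (Suc k) = Q k * gamma x (Suc k)" by (simp add: Q_def)
    have f: "?W * ?f k = t ^ r * z ^ r * ?a"
    proof -
      have "?W * ?f k = t ^ r * z ^ r * (?a / ?W * ?W)"
        unfolding Q_def[symmetric] by (simp only: ac_simps)
      also have "\<dots> = t ^ r * z ^ r * ?a"
        by (subst gf_divide_mult_cancel) (simp_all only: cW one_neq_zero not_False_eq_True)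
      finally show ?thesis .
    qed
    have "?W * R k = gamma x (Suc k) * delta x (Suc k) ^ p * H k * x ^ k
        * (Q k * delta x k ^ p * inverse (Q k * delta x k ^ p))"
      by (simp add: R_def Q_Suc ac_simps)
    also have "\<dots> = x * (t ^ r * z ^ r * (delta x k ^ p - delta x (Suc k) ^ p)
        + delta x k ^ p * H (Suc k)) * x ^ k"
      unfolding inv_Q H_def kernel_step[OF assms] by simp
    also have "\<dots> = ?W * ?f k + x ^ Suc k * delta x k ^ p * H (Suc k)
        * (Q (Suc k) * delta x (Suc k) ^ p * inverse (Q (Suc k) * delta x (Suc k) ^ p))"
      unfolding inv_Q f by (simp add: algebra_simps)
    also have "\<dots> = ?W * (?f k + R (Suc k))"
      by (simp only: R_def distrib_left ac_simps)
    finally show ?thesis using cW by (metis const_coeff_simps(1) mult_left_cancel zero_neq_one)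
  qed
  have R_0: "R 0 = series p r x 1"
    using gf_mult_inverse[of 1] by (simp add: R_def H_def Q_def)
  have "series p r x 1 - sum ?f {..<N} = R N" for N
  proof (induction N)
    case 0
    then show ?case by (simp add: R_0)
  next
    case (Suc N)
    then show ?case unfolding sum.lessThan_Suc step[of N] by (simp only: algebra_simps)
  qed
  moreover have "u ^ N dvd R N" for N
    unfolding R_def using assms(2) by (intro dvd_mult2 dvd_power_same)
  ultimately show ?thesis by (simp only: u_sums_def simp_thms)
qed

text \<open>To move the constant factor out of the infinite sum, the bare series is first shown to
  converge by \<open>u_sums_power_mult\<close>.\<close>

lemma series_one_eq:
  assumes "r \<ge> 1" and "u dvd x"
  shows "series p r x 1 = t ^ r * z ^ r * (\<Sum>k. x ^ Suc k * (delta x k ^ p - delta x (Suc k) ^ p) /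
     ((\<Prod>i=1..Suc k. gamma x i) * delta x k ^ p * delta x (Suc k) ^ p))"
    (is "_ = ?c * (\<Sum>k. ?f k)")
proof -
  have f_eq: "?f k = x ^ k * (x * (delta x k ^ p - delta x (Suc k) ^ p) *
      inverse ((\<Prod>i=1..Suc k. gamma x i) * delta x k ^ p * delta x (Suc k) ^ p))" for k
    by (subst gf_divide_eq)
      (simp_all add: const_coeff_delta_gamma[OF assms(2)] ac_simps del: prod.cl_ivl_Suc)
  have "u_sums ?f (\<Sum>k. ?f k)"
    unfolding f_eq by (rule u_sums_power_mult[OF assms(2)])
  then have "u_sums (\<lambda>k. ?c * ?f k) (?c * (\<Sum>k. ?f k))"
    by (rule u_sums_mult)
  from u_sums_unique[OF this] show ?thesis
    unfolding u_sums_unique[OF series_one_u_sums[OF assms]] .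
qed

section \<open>The counting series as a sum of polynomials in \<open>v\<close>\<close>

lemma G_eq_series:
  assumes "r \<ge> 1"
  shows "G p r = series p r u v"
proof -
  define g where "g a = Abs_fps (\<lambda>n. Abs_fps (\<lambda>l. zeros_poly p r n a l))" for a
  have G: "G p r = Abs_fps g"
    by (rule fps_ext) (simp add: G_def g_def zeros_poly_eq)
  have g: "last_poly p r a v = fps_const (g a)" for a
  proof -
    let ?V = "fps_const fps_X :: rat fps fps fps"
    have "g a = (\<Sum>l<p + a. Abs_fps (\<lambda>n. fps_const (zeros_poly p r n a l)) * ?V ^ l)"
    proof (rule fps_ext, rule fps_ext)
      fix n l
      \<comment> \<open>Last letters from \<open>p + a\<close> on do not occur, so the finite sum
        over \<open>l\<close> captures the whole series in \<open>v\<close>.\<close>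
      have "zeros_poly p r n a l = 0" if "p + a \<le> l"
        using asc_words_eq_empty[OF assms, of a p l n] that by (simp add: zeros_poly_def)
      then show "fps_nth (fps_nth (g a) n) l = fps_nth (fps_nth
          (\<Sum>l<p + a. Abs_fps (\<lambda>n. fps_const (zeros_poly p r n a l)) * ?V ^ l) n) l"
        by (auto simp: g_def fps_sum_nth fps_const_power fps_X_power_nth if_distrib cong: if_cong)
    qed
    then show ?thesis
      by (simp add: last_poly_def coef_def v_def fps_const_sum fps_const_power)
  qed
  \<comment> \<open>Each \<open>last_poly p r a v\<close> is constant in \<open>u\<close>, so the
    term with index \<open>a\<close> affects the coefficient of \<open>u ^ a\<close> alone.\<close>
  have "u_sums (\<lambda>a. u ^ a * last_poly p r a v) (Abs_fps g)"
    unfolding u_sums_def u_power_dvd_iff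
    by (simp add: g u_def fps_sum_nth fps_X_power_nth mult_delta_left)
  then show ?thesis
    unfolding G series_def by (rule u_sums_unique[symmetric])
qed


theorem theorem2p3:
  fixes p r :: nat
  assumes "p \<ge> 1" and "r \<ge> 1"
  shows "G p r = t ^ r * z ^ r *
    (t * u * v * (v ^ p - 1) / (v * \<delta> 1 - 1)
     + t * (z * (v - 1) - v) / (v * \<delta> 1 - 1) *
         (\<Sum>k. u ^ Suc k * (\<delta> k ^ p - \<delta> (Suc k) ^ p) /
            ((\<Prod>i=1..Suc k. \<gamma> i) * \<delta> k ^ p * \<delta> (Suc k) ^ p))
     + t * u * v ^ (p + 1) / (v * \<delta> 1 - 1) *
         (\<Sum>k. (u * v) ^ Suc k * (\<delta>bar k ^ p - \<delta>bar (Suc k) ^ p) /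
            ((\<Prod>i=1..Suc k. \<gamma>bar i) * \<delta>bar k ^ p * \<delta>bar (Suc k) ^ p)))"
proof -
  let ?d = "v * \<delta> 1 - 1"
  let ?A = "\<Sum>k. u ^ Suc k * (\<delta> k ^ p - \<delta> (Suc k) ^ p) /
            ((\<Prod>i=1..Suc k. \<gamma> i) * \<delta> k ^ p * \<delta> (Suc k) ^ p)"
  let ?B = "\<Sum>k. (u * v) ^ Suc k * (\<delta>bar k ^ p - \<delta>bar (Suc k) ^ p) /
            ((\<Prod>i=1..Suc k. \<gamma>bar i) * \<delta>bar k ^ p * \<delta>bar (Suc k) ^ p)"
  have d: "\<delta> = delta u" "\<delta>bar = delta (u * v)"
    by (auto simp: fun_eq_iff \<delta>_def \<delta>bar_def delta_def)
  have "(\<Prod>i=1..k. \<gamma> i) = (\<Prod>i=1..k. gamma u i)"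
    and "(\<Prod>i=1..k. \<gamma>bar i) = (\<Prod>i=1..k. gamma (u * v) i)" for k
    by (auto intro!: prod.cong simp: \<gamma>_def \<gamma>bar_def gamma_def)
  then have A: "series p r u 1 = t ^ r * z ^ r * ?A"
    and B: "series p r (u * v) 1 = t ^ r * z ^ r * ?B"
    using series_one_eq[OF assms(2), of u p] series_one_eq[OF assms(2), of "u * v" p]
    by (simp_all only: d dvd_refl dvd_triv_left)
  have cd: "const_coeff ?d \<noteq> 0" by simp
  then have "?d \<noteq> 0" by (metis const_coeff_simps(1))
  \<comment> \<open>At \<open>x = u\<close> and \<open>y = v\<close> the kernel is
    \<open>?d\<close>. As it is a unit, the division can wait until both sides carry it as a
    factor.\<close>
  have "?d * G p r = t ^ Suc r * z ^ r * u * v * (v ^ p - 1)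
      + t * (z * (v - 1) - v) * (t ^ r * z ^ r * ?A)
      + t * u * v ^ Suc p * (t ^ r * z ^ r * ?B)"
    using series_functional_equation[OF assms(2), of u v p]
    unfolding G_eq_series[OF assms(2)] A B
    by (simp add: \<delta>_def algebra_simps)
  also have "\<dots> = t ^ r * z ^ r * (t * u * v * (v ^ p - 1) * (?d * inverse ?d)
      + t * (z * (v - 1) - v) * (?d * inverse ?d) * ?A
      + t * u * v ^ (p + 1) * (?d * inverse ?d) * ?B)"
    unfolding gf_mult_inverse[OF cd] by (simp add: algebra_simps)
  also have "\<dots> = ?d * (t ^ r * z ^ r * (t * u * v * (v ^ p - 1) / ?d
      + t * (z * (v - 1) - v) / ?d * ?A + t * u * v ^ (p + 1) / ?d * ?B))"
    unfolding gf_divide_eq[OF cd] by (simp only: distrib_left ac_simps)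
  finally show ?thesis using \<open>?d \<noteq> 0\<close> by (simp only: mult_cancel_left) simp
qed

end
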